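(* Fix a positive integer $n\geq 2$ and let $p_1\geq 1$ and $p_2\geq 0$ be given integers such that $2p_1+p_2=n$. There exists a hypercyclic $(n+1)$-tuple of $n\times n$ matrices in Jordan form over $\mathbb R$ where each matrix in the tuple consists of $p_1$ Jordan blocks of dimension $2$ and $p_2$ Jordan blocks of dimension $1$.
   Context: $\mathbb N$ denotes the positive integers and $\mathbb N_0=\mathbb N\cup\{0\}$. For $l\in\mathbb N$ and $\gamma\in\mathbb R$, $\mathrm{Jrd}_{l,\gamma}$ denotes the $l\times l$ Jordan block with eigenvalue $\gamma$: the diagonal entries equal $\gamma$, the entries on the first superdiagonal equal $1$, and all other entries are $0$. An $n\times n$ matrix in Jordan form over $\mathbb R$ is a block-diagonal matrix $\mathrm{Jrd}_{n_1,\gamma_1}\oplus\cdots\oplus\mathrm{Jrd}_{n_p,\gamma_p}$ with $n_1+\cdots+n_p=n$ and $\gamma_1,\ldots,\gamma_p\in\mathbb R$. In a $k$-tuple $(T_1,\ldots,T_k)$ of matrices in Jordan form, all matrices have the same block structure, i.e. $T_\nu=\mathrm{Jrd}_{n_1,\gamma_\nu^{(1)}}\oplus\cdots\oplus\mathrm{Jrd}_{n_p,\gamma_\nu^{(p)}}$ with $p,n_1,\ldots,n_p$ independent of $\nu$ (so the matrices commute). A $k$-tuple $T=(T_1,\ldots,T_k)$ of commuting $n\times n$ real matrices is called hypercyclic if there exists a vector $x\in\mathbb R^n$ such that the set $\{T_1^{m_1}T_2^{m_2}\cdots T_k^{m_k}x : m_1,\ldots,m_k\in\mathbb N_0\}$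 is dense in $\mathbb R^n$. *)

theory Defs
  imports "HOL-Analysis.Analysis" "Jordan_Normal_Form.Jordan_Normal_Form"
begin

unbundle no vec_syntax

text \<open>
  A tuple of matrices is a list.  The list \<open>ns\<close> is the block structure shared by all members
  of the tuple; only the eigenvalues \<open>\<gamma>s\<close> of the blocks depend on the member.
\<close>

definition jordan_form_tuple :: "nat list \<Rightarrow> real mat list \<Rightarrow> bool" where
  "jordan_form_tuple ns Ts \<longleftrightarrow>
     0 \<notin> set ns \<and>
     (\<forall>T\<in>set Ts. \<exists>\<gamma>s. length \<gamma>s = length ns \<and> T = jordan_matrix (zip ns \<gamma>s))"

text \<open>
  For \<open>Ts = [T\<^sub>1, \<dots>, T\<^sub>k]\<close> and \<open>ms = [m\<^sub>1, \<dots>, m\<^sub>k]\<close> this is the product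
  \<open>T\<^sub>1 ^ m\<^sub>1 * (T\<^sub>2 ^ m\<^sub>2 * (\<dots> * (T\<^sub>k ^ m\<^sub>k * 1)))\<close>.
\<close>

definition tuple_power :: "nat \<Rightarrow> real mat list \<Rightarrow> nat list \<Rightarrow> real mat" where
  "tuple_power n Ts ms = foldr (\<lambda>(T, m) M. T ^\<^sub>m m * M) (zip Ts ms) (1\<^sub>m n)"

text \<open>
  The type \<^typ>\<open>real vec\<close> contains vectors of all dimensions and carries no topology; density in
  \<open>\<real>\<^sup>n\<close> refers to \<^const>\<open>Euclidean_space\<close>, whose points are the sequences vanishing from
  index \<open>n\<close> on.
\<close>

definition coords :: "real vec \<Rightarrow> nat \<Rightarrow> real" where
  "coords v = (\<lambda>i. if i < dim_vec v then vec_index v i else 0)"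

definition dense_in_Rn :: "nat \<Rightarrow> real vec set \<Rightarrow> bool" where
  "dense_in_Rn n S \<longleftrightarrow>
     S \<subseteq> carrier_vec n \<and>
     Euclidean_space n closure_of (coords ` S) = topspace (Euclidean_space n)"

definition hypercyclic :: "nat \<Rightarrow> real mat list \<Rightarrow> bool" where
  "hypercyclic n Ts \<longleftrightarrow>
     set Ts \<subseteq> carrier_mat n n \<and>
     (\<forall>A\<in>set Ts. \<forall>B\<in>set Ts. A * B = B * A) \<and>
     (\<exists>x\<in>carrier_vec n.
        dense_in_Rn n {tuple_power n Ts ms *\<^sub>v x | ms. length ms = length Ts})"

end

theory Submission
  imports Defs
begin

text \<open>
  Apply the tuple to the vector with entries \<open>(0, 1)\<close> in each block of size 2 and \<open>1\<close> in each block
  of size 1.  If \<open>\<gamma>\<^sub>0, \<dots>, \<gamma>\<^sub>n\<close> are the eigenvalues of a block of size 2, the orbit there consists of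
  the vectors \<open>(g * s, g)\<close> with \<open>g = \<Prod> \<gamma>\<^sub>i ^ m\<^sub>i\<close> and \<open>s = \<Sum> m\<^sub>i / \<gamma>\<^sub>i\<close>.  Up to the signs of the \<open>g\<close>, which
  the parities of the \<open>m\<^sub>i\<close> control, density of the orbit therefore means density in \<open>\<real>\<^sup>n\<close> of the
  additive semigroup generated by the \<open>n + 1\<close> vectors \<open>v\<^sub>i\<close> with the entries \<open>ln \<bar>\<gamma>\<^sub>i\<bar>\<close> for each block
  and \<open>1 / \<gamma>\<^sub>i\<close> for each block of size 2.

  By Kronecker's theorem this holds if \<open>v\<^sub>0, \<dots>, v\<^sub>n\<^sub>-\<^sub>1\<close> span \<open>\<real>\<^sup>n\<close> and \<open>v\<^sub>n = - \<Sum> \<theta>\<^sub>i * v\<^sub>i\<close> with positive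
  \<open>\<theta>\<^sub>i\<close> that are linearly independent over the rationals together with \<open>1\<close>.  For a block of size 2 the
  two conditions on \<open>\<gamma>\<^sub>n\<close> are compatible only if \<open>\<bar>\<Sum> \<theta>\<^sub>i / \<gamma>\<^sub>i\<bar> * \<Prod> \<bar>1 / \<gamma>\<^sub>i\<bar> powr \<theta>\<^sub>i = 1\<close>.  Choosing all but
  one of the \<open>1 / \<gamma>\<^sub>i\<close> to be \<open>1\<close> or \<open>-1\<close>, the remaining one solves this equation by the intermediate
  value theorem.
\<close>

section \<open>Rational independence and simultaneous approximation with natural
  coefficients\<close>

definition independent_with_one :: "nat \<Rightarrow> (nat \<Rightarrow> real) \<Rightarrow> bool" where
  "independent_with_one n \<theta> \<longleftrightarrow>
     (\<forall>(a::nat \<Rightarrow> int) b. (\<Sum>i<n. of_int (a i) * \<theta> i) + of_int b = 0 \<longrightarrow> b = 0 \<and> (\<forall>i<n. a i = 0))"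

lemma independent_with_oneD:
  fixes a :: "nat \<Rightarrow> int"
  assumes "independent_with_one n \<theta>" "(\<Sum>i<n. of_int (a i) * \<theta> i) + of_int b = 0"
  shows "b = 0" "i < n \<Longrightarrow> a i = 0"
  using assms unfolding independent_with_one_def by metis+

text \<open>Entries are added one at a time. Every integer relation involving the new entry
  determines it, so only countably many values in the interval are excluded. The bound
  \<open>\<delta>\<close> later keeps the sum of the \<open>\<theta> i\<close> below 1.\<close>

lemma exists_independent_small:
  fixes \<delta> :: real
  assumes "\<delta> > 0"
  shows "\<exists>\<theta>. (\<forall>i<n. 0 < \<theta> i \<and> \<theta> i < \<delta>) \<and> independent_with_one n \<theta>"
proof (induction n)
  case 0
  show ?case by (auto simp: independent_with_one_def)
next
  case (Suc n)
  then obtain \<theta> :: "nat \<Rightarrow> real" where pos: "\<And>i. i < n \<Longrightarrow> 0 < \<theta> i \<and> \<theta> i < \<delta>"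
    and ind: "independent_with_one n \<theta>"
    by blast
  \<comment> \<open>Lists serve as coefficient vectors because they form a countable type, unlike
    \<open>nat \<Rightarrow> int\<close>. Triples with \<open>d = 0\<close> contribute only the
    value 0.\<close>
  define bad where "bad = (\<lambda>(as :: int list, b :: int, d :: int). - ((\<Sum>i<n. of_int (as ! i) * \<theta> i) + of_int b) / of_int d) ` UNIV"
  have "countable bad"
    unfolding bad_def by (intro countable_image) auto
  moreover have "uncountable {0<..<\<delta>}"
    using assms uncountable_open_interval by blast
  ultimately obtain t where t: "t \<in> {0<..<\<delta>}" "t \<notin> bad"
    by (metis countable_subset subsetI)
  show ?case
    unfolding independent_with_one_def
  proof (intro exI[of _ "\<theta>(n := t)"] conjI allI impI)
    fix i assume "i < Suc n"
    then show "0 < (\<theta>(n := t)) i" "(\<theta>(n := t)) i < \<delta>" using pos t by (auto simp: less_Suc_eq)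
  next
    fix a :: "nat \<Rightarrow> int" and b :: int
    assume *: "(\<Sum>i<Suc n. of_int (a i) * (\<theta>(n := t)) i) + of_int b = 0"
    then have eq: "(\<Sum>i<n. of_int (a i) * \<theta> i) + of_int (a n) * t + of_int b = 0" by simp
    have an: "a n = 0"
    proof (rule ccontr)
      assume nz: "a n \<noteq> 0"
      have "(\<Sum>i<n. of_int (map a [0..<n] ! i) * \<theta> i) = (\<Sum>i<n. of_int (a i) * \<theta> i)"
        by (intro sum.cong) auto
      with eq nz have "t = - ((\<Sum>i<n. of_int (map a [0..<n] ! i) * \<theta> i) + of_int b) / of_int (a n)"
        by (simp add: field_simps)
      then have "t \<in> bad" unfolding bad_def by (intro image_eqI[where x = "(map a [0..<n], b, a n)"]) simp_all
      with t show False by blast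
    qed
    with eq have "(\<Sum>i<n. of_int (a i) * \<theta> i) + of_int b = 0" by simp
    from independent_with_oneD[OF ind this] an
    show "b = 0" "\<And>i. i < Suc n \<Longrightarrow> a i = 0" by (auto simp: less_Suc_eq)
  qed
qed

text \<open>Kronecker's theorem yields integers of either sign. Adding a multiple of a simultaneous
  Dirichlet approximation with positive denominator makes them nonnegative at small cost. Thus the
  semigroup generated by the unit vectors and \<open>- \<theta>\<close> is dense.\<close>

lemma Kronecker_nat:
  fixes \<theta> w :: "nat \<Rightarrow> real"
  assumes pos: "\<And>i. i < n \<Longrightarrow> 0 < \<theta> i"
    and ind: "independent_with_one n \<theta>"
    and "\<epsilon> > 0"
  shows "\<exists>k m. \<forall>i<n. \<bar>real (m i) - real k * \<theta> i - w i\<bar> < \<epsilon>"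
proof -
  \<comment> \<open>The entry 1 at index \<open>n\<close> turns independence together with 1 into
    independence of the family \<open>\<theta>' 0, ..., \<theta>' n\<close>.\<close>
  define \<theta>' where "\<theta>' = \<theta>(n := 1)"
  \<comment> \<open>The reals as a module over the integers, so that \<open>independent\<close>
    speaks of integer relations, as in Kronecker's theorem.\<close>
  interpret Modules.module "(\<lambda>r. (*) (real_of_int r))"
    by (simp add: Modules.module.intro distrib_left mult.commute)
  have combo: "(\<Sum>i\<le>n. of_int (a i) * \<theta>' i) = (\<Sum>i<n. of_int (a i) * \<theta> i) + of_int (a n)" for a :: "nat \<Rightarrow> int"
    by (simp add: \<theta>'_def lessThan_Suc_atMost[symmetric])
  have zero: "\<forall>i\<le>n. a i = 0" if "(\<Sum>i\<le>n. of_int (a i) * \<theta>' i) = 0" for a :: "nat \<Rightarrow> int"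
    using independent_with_oneD[OF ind that[unfolded combo]] by (auto simp: le_less)
  have inj: "inj_on \<theta>' {..n}"
  proof (rule inj_onI, rule ccontr)
    fix x y assume xy: "x \<in> {..n}" "y \<in> {..n}" "\<theta>' x = \<theta>' y" "x \<noteq> y"
    define a :: "nat \<Rightarrow> int" where "a = (\<lambda>i. if i = x then 1 else if i = y then -1 else 0)"
    have "(\<Sum>i\<le>n. of_int (a i) * \<theta>' i) = (\<Sum>i\<in>{x,y}. of_int (a i) * \<theta>' i)"
      by (rule sum.mono_neutral_right) (use xy in \<open>auto simp: a_def\<close>)
    also have "\<dots> = 0" using xy by (simp add: a_def)
    finally show False using zero[of a] xy by (auto simp: a_def split: if_splits)
  qed
  have indep: "independent (\<theta>' ` {..n})"
    unfolding independent_explicit_module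
  proof (intro allI impI)
    fix T :: "real set" and f :: "real \<Rightarrow> int" and x
    assume T: "finite T" "T \<subseteq> \<theta>' ` {..n}" and s: "(\<Sum>x\<in>T. of_int (f x) * x) = 0" and x: "x \<in> T"
    define g where "g = (\<lambda>x. if x \<in> T then f x else 0)"
    have "(\<Sum>i\<le>n. of_int ((g \<circ> \<theta>') i) * \<theta>' i) = (\<Sum>x\<in>\<theta>' ` {..n}. of_int (g x) * x)"
      by (simp add: sum.reindex[OF inj])
    also have "\<dots> = (\<Sum>x\<in>T. of_int (f x) * x)"
      by (rule sum.mono_neutral_cong_right) (use T in \<open>auto simp: g_def\<close>)
    finally have "\<forall>i\<le>n. (g \<circ> \<theta>') i = 0" using zero[of "g \<circ> \<theta>'"] s by simp
    moreover obtain i where "i \<le> n" "x = \<theta>' i" using x T(2) by auto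
    ultimately show "f x = 0" using x by (auto simp: g_def)
  qed
  \<comment> \<open>The theorem approximates by \<open>k * \<theta> - m\<close>, hence the negated
    target. The other half of \<open>\<epsilon>\<close> is reserved for the correction.\<close>
  obtain k m where km: "\<And>i. i < n \<Longrightarrow> \<bar>of_int k * \<theta>' i - of_int (m i) - (- w i)\<bar> < \<epsilon>/2"
    by (rule Kronecker_thm_2[OF indep inj, of "\<epsilon>/2" "\<lambda>i. - w i"]) (use assms in \<open>auto simp: \<theta>'_def\<close>)
  \<comment> \<open>From \<open>B\<close> on, \<open>K * \<theta> i\<close> is at least
    \<open>\<bar>w i\<bar> + \<epsilon>\<close>, so an integer within \<open>\<epsilon>\<close> of
    \<open>K * \<theta> i + w i\<close> is nonnegative.\<close>
  obtain B :: nat where B: "\<And>i. i < n \<Longrightarrow> (\<bar>w i\<bar> + \<epsilon>) / \<theta> i \<le> real B"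
  proof -
    have "real (nat \<lceil>Max ((\<lambda>i. (\<bar>w i\<bar> + \<epsilon>) / \<theta> i) ` {..<n})\<rceil>) \<ge> (\<bar>w i\<bar> + \<epsilon>) / \<theta> i" if "i < n" for i
    proof -
      have "(\<bar>w i\<bar> + \<epsilon>) / \<theta> i \<le> Max ((\<lambda>i. (\<bar>w i\<bar> + \<epsilon>) / \<theta> i) ` {..<n})"
        by (rule Max_ge) (use that in auto)
      then show ?thesis using real_nat_ceiling_ge order_trans by blast
    qed
    then show ?thesis using that by blast
  qed
  \<comment> \<open>A large multiple of a simultaneous Dirichlet approximation makes all coefficients nonnegative.\<close>
  define J where "J = nat \<bar>k\<bar> + B + 1"
  \<comment> \<open>The error \<open>1 / N\<close> of the Dirichlet approximation will be incurred
    \<open>J\<close> times.\<close>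
  obtain N :: nat where N: "N > 0" "real J * (1/N) < \<epsilon>/2"
  proof -
    obtain N :: nat where "real N > real J / (\<epsilon>/2)" using reals_Archimedean2 by blast
    moreover from this have "N > 0" using assms(3)
      by (metis divide_nonneg_pos half_gt_zero less_le_not_le of_nat_0 of_nat_0_le_iff gr0I)
    ultimately show ?thesis using assms(3) that[of N] by (simp add: field_simps)
  qed
  obtain q p where q: "0 < q" and p: "\<And>i. i < n \<Longrightarrow> \<bar>of_int q * \<theta> i - of_int (p i)\<bar> < 1 / N"
    using Dirichlet_approx_simult[OF N(1), of n \<theta>] by metis
  define K where "K = k + int J * q"
  define M where "M = (\<lambda>i. m i + int J * p i)"
  have "int J * q \<ge> int J" using q by (simp add: mult_le_cancel_left1)
  then have KB: "K \<ge> int B" unfolding K_def J_def by linarith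
  have approx: "\<bar>of_int (M i) - of_int K * \<theta> i - w i\<bar> < \<epsilon>" if "i < n" for i
  proof -
    have "\<bar>of_int (M i) - of_int K * \<theta> i - w i\<bar>
      = \<bar>(of_int k * \<theta>' i - of_int (m i) - (- w i)) + real J * (of_int q * \<theta> i - of_int (p i))\<bar>"
      using that by (simp add: M_def K_def \<theta>'_def algebra_simps abs_minus_commute)
    also have "\<dots> \<le> \<bar>of_int k * \<theta>' i - of_int (m i) - (- w i)\<bar> + real J * \<bar>of_int q * \<theta> i - of_int (p i)\<bar>"
      by (metis abs_mult abs_of_nat abs_triangle_ineq)
    also have "\<dots> < \<epsilon>/2 + \<epsilon>/2"
      using km[OF that] mult_left_mono[OF less_imp_le[OF p[OF that]], of "real J"] N(2) by linarith
    finally show ?thesis by simp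
  qed
  have "M i \<ge> 0" if "i < n" for i
  proof -
    have "\<bar>w i\<bar> + \<epsilon> \<le> real B * \<theta> i"
      using B[OF that] pos[OF that] by (simp add: field_simps)
    also have "\<dots> \<le> of_int K * \<theta> i"
      using KB pos[OF that] by (intro mult_right_mono) linarith+
    finally show ?thesis using approx[OF that] by linarith
  qed
  then show ?thesis using approx KB
    by (intro exI[of _ "nat K"] exI[of _ "\<lambda>i. nat (M i)"]) auto
qed

text \<open>Approximating \<open>(w - e) / 2\<close> and passing to \<open>2 * k\<close> and
  \<open>2 * m + e\<close> prescribes the parities and only doubles the error.\<close>

lemma Kronecker_nat_parity:
  fixes \<theta> w :: "nat \<Rightarrow> real" and e :: "nat \<Rightarrow> nat"
  assumes pos: "\<And>i. i < n \<Longrightarrow> 0 < \<theta> i"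
    and ind: "independent_with_one n \<theta>"
    and "\<epsilon> > 0"
  shows "\<exists>k m. even k \<and> (\<forall>i<n. even (m i) = even (e i)) \<and> (\<forall>i<n. \<bar>real (m i) - real k * \<theta> i - w i\<bar> < \<epsilon>)"
proof -
  obtain k m where km: "\<And>i. i < n \<Longrightarrow> \<bar>real (m i) - real k * \<theta> i - (w i - real (e i)) / 2\<bar> < \<epsilon> / 2"
    using Kronecker_nat[of n \<theta> "\<epsilon> / 2" "\<lambda>i. (w i - real (e i)) / 2"] pos ind half_gt_zero[OF assms(3)] by metis
  have "\<bar>real (2 * m i + e i) - real (2 * k) * \<theta> i - w i\<bar> < \<epsilon>" if "i < n" for i
    using km[OF that] by (simp add: abs_less_iff field_simps)
  then show ?thesis
    by (intro exI[of _ "2*k"] exI[of _ "\<lambda>i. 2 * m i + e i"]) auto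
qed

section \<open>Choice of the eigenvalues\<close>

text \<open>The compatibility equation of a block of size 2, with \<open>- t\<close> as the free
  reciprocal and \<open>c\<close> as its coefficient. The left side is below 1 at
  \<open>t = 1\<close> and at least 1 at \<open>t = 2 / c\<close>, where
  \<open>\<bar>K - 2\<bar> \<ge> 1\<close>. Strictness of \<open>t > 1\<close> makes
  \<open>ln t\<close> nonzero.\<close>

lemma exists_abs_mult_powr_eq_1:
  fixes c K :: real
  assumes "c > 0" "\<bar>K\<bar> + c < 1"
  shows "\<exists>t>1. \<bar>K - c * t\<bar> * t powr c = 1"
proof -
  let ?f = "\<lambda>t. \<bar>K - c * t\<bar> * t powr c"
  have "2 / c \<ge> 1" using assms by (simp add: field_simps)
  have "\<exists>t\<ge>1. t \<le> 2 / c \<and> ?f t = 1"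
  proof (rule IVT')
    show "?f 1 \<le> 1" using assms by simp
    have "1 \<le> (2 / c) powr c" using \<open>2 / c \<ge> 1\<close> assms by (intro ge_one_powr_ge_zero) auto
    moreover have "1 \<le> \<bar>K - c * (2 / c)\<bar>" using assms by simp
    ultimately show "1 \<le> ?f (2 / c)" by (metis mult_mono mult_1 zero_le_one abs_ge_zero)
    show "continuous_on {1..2/c} ?f" by (intro continuous_intros) auto
  qed fact
  then obtain t where t: "t \<ge> 1" "?f t = 1" by blast
  have "?f 1 < 1" using assms by simp
  then have "t \<noteq> 1" using t by auto
  with t show ?thesis by force
qed

text \<open>In terms of the partial sums \<open>P\<close> of \<open>u\<close>, row \<open>j\<close>
  reads \<open>2 * P (j + 1) - P p = d j\<close>. The last row gives \<open>P p = d (p - 1)\<close>,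
  which determines the other sums.\<close>

lemma sign_system_solvable:
  fixes d :: "nat \<Rightarrow> real"
  assumes "p \<ge> 1"
  shows "\<exists>u. \<forall>j<p. (\<Sum>k<p. (if k \<le> j then 1 else -1) * u k) = d j"
proof -
  define P where "P = (\<lambda>j. if j = 0 then 0 else (d (j - 1) + d (p - 1)) / 2)"
  define u where "u = (\<lambda>k. P (Suc k) - P k)"
  have P: "(\<Sum>k<m. u k) = P m" for m
    using sum_lessThan_telescope[of P m] by (simp add: u_def P_def[THEN fun_cong, of 0])
  have "(\<Sum>k<p. (if k \<le> j then 1 else -1) * u k) = d j" if "j < p" for j
  proof -
    have "(\<Sum>k<p. (if k \<le> j then 1 else -1) * u k) = (\<Sum>k<p. 2 * (if k < Suc j then u k else 0) - u k)"
      by (intro sum.cong) auto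
    also have "\<dots> = 2 * (\<Sum>k<p. if k < Suc j then u k else 0) - (\<Sum>k<p. u k)"
      by (simp add: sum_subtractf sum_distrib_left)
    also have "(\<Sum>k<p. if k < Suc j then u k else 0) = (\<Sum>k<Suc j. u k)"
      using that by (intro sum.mono_neutral_cong_right) auto
    finally show ?thesis
      using assms unfolding P by (simp add: P_def field_simps)
  qed
  then show ?thesis by blast
qed

lemma sum_lessThan_add:
  fixes f :: "nat \<Rightarrow> real"
  shows "(\<Sum>i<a + b. f i) = (\<Sum>i<a. f i) + (\<Sum>k<b. f (a + k))"
  by (induction b) (simp_all add: algebra_simps)

text \<open>The spanning system is triangular: the first \<open>p\<close> generators settle the
  logarithms, and the last \<open>p\<^sub>1\<close> of the first \<open>n\<close> then settle the
  sums of reciprocals. The sign clause lets the parity of the exponent of generator \<open>b\<close>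
  control the sign in block \<open>b\<close>.\<close>

lemma exists_eigenvalues:
  assumes p1: "p\<^sub>1 \<ge> 1" and p: "p = p\<^sub>1 + p\<^sub>2" and n: "n = p + p\<^sub>1"
    and pos: "\<forall>i<n. 0 < \<theta> i" and small: "(\<Sum>i<n. \<theta> i) < 1"
  shows "\<exists>\<gamma> :: nat \<Rightarrow> nat \<Rightarrow> real.
    (\<forall>i\<le>n. \<forall>b<p. \<gamma> i b \<noteq> 0) \<and>
    (\<forall>b<p. ln \<bar>\<gamma> n b\<bar> = - (\<Sum>i<n. \<theta> i * ln \<bar>\<gamma> i b\<bar>)) \<and>
    (\<forall>j<p\<^sub>1. 1 / \<gamma> n j = - (\<Sum>i<n. \<theta> i * (1 / \<gamma> i j))) \<and>
    (\<forall>i<p. \<forall>b<p. \<gamma> i b < 0 \<longleftrightarrow> i = b) \<and>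
    (\<forall>A B. \<exists>w. (\<forall>b<p. (\<Sum>i<n. w i * ln \<bar>\<gamma> i b\<bar>) = A b) \<and>
                (\<forall>j<p\<^sub>1. (\<Sum>i<n. w i * (1 / \<gamma> i j)) = B j))"
proof -
  \<comment> \<open>\<open>\<beta> j i\<close> is \<open>1 / \<gamma> i j\<close>.  As \<open>\<beta> j i = \<plusminus>1\<close> for \<open>i \<noteq> j\<close>, only the \<open>j\<close>-th generator sees the logarithm of
    block \<open>j\<close>; the signs of the last \<open>p\<^sub>1\<close> generators form an invertible matrix.\<close>
  define \<sigma> :: "nat \<Rightarrow> nat \<Rightarrow> real" where
    "\<sigma> = (\<lambda>j i. if i < p \<or> i - p \<le> j then 1 else -1)"
  have "\<exists>t>1. \<bar>(\<Sum>i\<in>{..<n}-{j}. \<theta> i * \<sigma> j i) - \<theta> j * t\<bar> * t powr \<theta> j = 1" if "j < p\<^sub>1" for j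
  proof (rule exists_abs_mult_powr_eq_1)
    have j: "j < n" using that n by simp
    show "\<theta> j > 0" using pos j by blast
    have "\<bar>\<Sum>i\<in>{..<n}-{j}. \<theta> i * \<sigma> j i\<bar> \<le> (\<Sum>i\<in>{..<n}-{j}. \<theta> i)"
      by (rule order_trans[OF sum_abs sum_mono]) (use pos in \<open>auto simp: \<sigma>_def abs_mult less_imp_le\<close>)
    moreover have "(\<Sum>i<n. \<theta> i) = \<theta> j + (\<Sum>i\<in>{..<n}-{j}. \<theta> i)"
      using j by (intro sum.remove) auto
    ultimately show "\<bar>\<Sum>i\<in>{..<n}-{j}. \<theta> i * \<sigma> j i\<bar> + \<theta> j < 1" using small by linarith
  qed
  then obtain t where t1: "\<And>j. j < p\<^sub>1 \<Longrightarrow> t j > 1"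
    and t: "\<And>j. j < p\<^sub>1 \<Longrightarrow> \<bar>(\<Sum>i\<in>{..<n}-{j}. \<theta> i * \<sigma> j i) - \<theta> j * t j\<bar> * t j powr \<theta> j = 1"
    by metis
  \<comment> \<open>The minus sign makes \<open>\<gamma> j j\<close> negative, while
    \<open>\<sigma> j i = 1\<close> for all \<open>i < p\<close>.\<close>
  define \<beta> where "\<beta> = (\<lambda>j i. if i = j then - t j else \<sigma> j i)"
  \<comment> \<open>In a block of size 2, the last eigenvalue is defined by the condition on
    reciprocals, and the choice of \<open>t\<close> must provide the one on logarithms. In a block
    of size 1 only the latter arises, and the logarithms are 1 for generator \<open>b\<close> and 0
    for the others below \<open>n\<close>.\<close>
  define \<gamma> where "\<gamma> = (\<lambda>i b. if b < p\<^sub>1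
      then (if i < n then 1 / \<beta> b i else - 1 / (\<Sum>i<n. \<theta> i * \<beta> b i))
      else (if i < n then (if i = b then - exp 1 else 1) else exp (- \<theta> b)))"
  have sum_\<beta>: "(\<Sum>i<n. f i * \<beta> j i) = (\<Sum>i\<in>{..<n}-{j}. f i * \<sigma> j i) - f j * t j" if "j < p\<^sub>1" for f j
  proof -
    have "(\<Sum>i<n. f i * \<beta> j i) = f j * \<beta> j j + (\<Sum>i\<in>{..<n}-{j}. f i * \<beta> j i)"
      using that n by (intro sum.remove) auto
    also have "(\<Sum>i\<in>{..<n}-{j}. f i * \<beta> j i) = (\<Sum>i\<in>{..<n}-{j}. f i * \<sigma> j i)"
      by (intro sum.cong) (auto simp: \<beta>_def)
    finally show ?thesis by (simp add: \<beta>_def)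
  qed
  have t': "\<bar>\<Sum>i<n. \<theta> i * \<beta> j i\<bar> * t j powr \<theta> j = 1" if "j < p\<^sub>1" for j
    using t[OF that] unfolding sum_\<beta>[OF that] .
  then have nz: "(\<Sum>i<n. \<theta> i * \<beta> j i) \<noteq> 0" if "j < p\<^sub>1" for j
    using that by fastforce
  have \<beta>_nz: "\<beta> j i \<noteq> 0" if "j < p\<^sub>1" for i j
    using t1[OF that] by (auto simp: \<beta>_def \<sigma>_def)
  have inv: "1 / \<gamma> i j = \<beta> j i" if "i < n" "j < p\<^sub>1" for i j
    using that by (simp add: \<gamma>_def)
  have ln2: "ln \<bar>\<gamma> i j\<bar> = (if i = j then - ln (t j) else 0)" if "i < n" "j < p\<^sub>1" for i j
    using that t1[of j] by (auto simp: \<gamma>_def \<beta>_def \<sigma>_def ln_div)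
  have ln1: "ln \<bar>\<gamma> i b\<bar> = (if i = b then 1 else 0)" if "i < n" "\<not> b < p\<^sub>1" for i b
    using that by (auto simp: \<gamma>_def)
  have delta: "(\<Sum>i<n. f i * (if i = b then c else 0)) = f b * c" if "b < n" for f :: "nat \<Rightarrow> real" and b c
    using that by (simp add: if_distrib[of "\<lambda>x. _ * x"] sum.delta cong: if_cong)
  have ln_sum: "(\<Sum>i<n. f i * ln \<bar>\<gamma> i b\<bar>) = f b * (if b < p\<^sub>1 then - ln (t b) else 1)" if "b < p" for f b
    using that n delta[of b f] ln1[of _ b] ln2[of _ b] by (cases "b < p\<^sub>1") (simp_all cong: sum.cong_simp)
  have "\<gamma> i b \<noteq> 0" if "i \<le> n" "b < p" for i b
    using \<beta>_nz nz by (auto simp: \<gamma>_def)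
  moreover have "ln \<bar>\<gamma> n b\<bar> = - (\<Sum>i<n. \<theta> i * ln \<bar>\<gamma> i b\<bar>)" if "b < p" for b
  proof (cases "b < p\<^sub>1")
    case True
    define S where "S = \<bar>\<Sum>i<n. \<theta> i * \<beta> b i\<bar>"
    have "S > 0" using nz[OF True] by (simp add: S_def)
    \<comment> \<open>The logarithm of the equation defining \<open>t\<close> is the condition on
      the logarithm of the last eigenvalue.\<close>
    have "ln (S * t b powr \<theta> b) = 0" using t'[OF True] by (simp add: S_def)
    then have "ln S + \<theta> b * ln (t b) = 0"
      using \<open>S > 0\<close> t1[OF True] by (simp add: ln_mult ln_powr)
    moreover have "ln \<bar>\<gamma> n b\<bar> = - ln S"
      using True \<open>S > 0\<close> by (simp add: \<gamma>_def S_def[symmetric] abs_divide ln_div)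
    ultimately show ?thesis using ln_sum[OF that] True by simp
  qed (use ln_sum[OF that] in \<open>simp add: \<gamma>_def\<close>)
  moreover have "1 / \<gamma> n j = - (\<Sum>i<n. \<theta> i * (1 / \<gamma> i j))" if "j < p\<^sub>1" for j
    using that inv by (simp add: \<gamma>_def)
  moreover have "\<gamma> i b < 0 \<longleftrightarrow> i = b" if "i < p" "b < p" for i b
    using that t1[of b] n by (auto simp: \<gamma>_def \<beta>_def \<sigma>_def)
  moreover have "\<exists>w. (\<forall>b<p. (\<Sum>i<n. w i * ln \<bar>\<gamma> i b\<bar>) = A b) \<and>
                (\<forall>j<p\<^sub>1. (\<Sum>i<n. w i * (1 / \<gamma> i j)) = B j)" for A B
  proof -
    define v where "v = (\<lambda>b. A b / (if b < p\<^sub>1 then - ln (t b) else 1))"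
    obtain u where u: "\<And>j. j < p\<^sub>1 \<Longrightarrow> (\<Sum>k<p\<^sub>1. (if k \<le> j then 1 else -1) * u k) = B j - (\<Sum>i<p. v i * \<beta> j i)"
      using sign_system_solvable[OF p1, of "\<lambda>j. B j - (\<Sum>i<p. v i * \<beta> j i)"] by blast
    \<comment> \<open>The coefficients \<open>u\<close> at the indices from \<open>p\<close> on
      leave the logarithms unchanged and correct the sums of reciprocals.\<close>
    define w where "w = (\<lambda>i. if i < p then v i else u (i - p))"
    have "(\<Sum>i<n. w i * ln \<bar>\<gamma> i b\<bar>) = A b" if "b < p" for b
      using ln_sum[OF that] that t1[of b] by (auto simp: w_def v_def)
    moreover have "(\<Sum>i<n. w i * (1 / \<gamma> i j)) = B j" if "j < p\<^sub>1" for j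
    proof -
      have "(\<Sum>i<n. w i * (1 / \<gamma> i j)) = (\<Sum>i<n. w i * \<beta> j i)"
        using inv that by simp
      also have "\<dots> = (\<Sum>i<p. w i * \<beta> j i) + (\<Sum>k<p\<^sub>1. w (p + k) * \<beta> j (p + k))"
        unfolding n sum_lessThan_add ..
      also have "(\<Sum>i<p. w i * \<beta> j i) = (\<Sum>i<p. v i * \<beta> j i)"
        by (simp add: w_def)
      also have "(\<Sum>k<p\<^sub>1. w (p + k) * \<beta> j (p + k)) = (\<Sum>k<p\<^sub>1. (if k \<le> j then 1 else -1) * u k)"
        using that p by (intro sum.cong) (auto simp: w_def \<beta>_def \<sigma>_def)
      finally show ?thesis using u[OF that] by simp
    qed
    ultimately show ?thesis by blast
  qed
  ultimately show ?thesis by (intro exI[of _ \<gamma>]) blast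
qed

section \<open>Arithmetic of matrices with blocks of size 2 and 1\<close>

definition block_index :: "nat \<Rightarrow> nat \<Rightarrow> nat" where
  "block_index p i = (if i < 2 * p then i div 2 else i - p)"

text \<open>
  Block-diagonal with \<open>p\<close> blocks of size 2 followed by blocks of size 1.  The superdiagonal entries are
  normalised to \<open>g * s\<close> so that multiplication becomes \<open>(g * g', s + s')\<close>.
\<close>

definition jordan_like :: "nat \<Rightarrow> nat \<Rightarrow> (nat \<Rightarrow> real) \<Rightarrow> (nat \<Rightarrow> real) \<Rightarrow> real mat" where
  "jordan_like p n g s = mat n n (\<lambda>(i, j).
     if j = i then g (block_index p i)
     else if even i \<and> i < 2 * p \<and> j = Suc i then g (block_index p i) * s (block_index p i) else 0)"

lemma block_index_Suc [simp]:
  "block_index (Suc p) 0 = 0" "block_index (Suc p) (Suc 0) = 0"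
  "block_index (Suc p) (Suc (Suc i)) = Suc (block_index p i)"
  by (auto simp: block_index_def)

lemma jordan_like_carrier [simp]: "jordan_like p n g s \<in> carrier_mat n n"
  by (simp add: jordan_like_def)

lemma jordan_like_cong:
  assumes "2 * p \<le> n" "\<And>b. b < n - p \<Longrightarrow> g b = g' b" "\<And>b. b < p \<Longrightarrow> s b = s' b"
  shows "jordan_like p n g s = jordan_like p n g' s'"
  using assms by (intro eq_matI) (auto simp: jordan_like_def block_index_def)

lemma jordan_like_one: "jordan_like p n (\<lambda>_. 1) (\<lambda>_. 0) = 1\<^sub>m n"
  by (rule eq_matI) (auto simp: jordan_like_def)

text \<open>A row has at most two nonzero entries. The formula serves both matrix products and the
  action on a vector.\<close>

lemma jordan_like_row_sum:
  assumes i: "i < n" and "2 * p \<le> n"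
  shows "(\<Sum>k = 0..<n. jordan_like p n g s $$ (i, k) * f k) =
    g (block_index p i) * (f i + (if even i \<and> i < 2 * p then s (block_index p i) * f (Suc i) else 0))"
proof (cases "even i \<and> i < 2 * p")
  case True
  then have "Suc i \<noteq> 2 * p" by presburger
  with True assms(2) have "Suc i < n" by linarith
  have "(\<Sum>k = 0..<n. jordan_like p n g s $$ (i, k) * f k) = (\<Sum>k\<in>{i, Suc i}. jordan_like p n g s $$ (i, k) * f k)"
    by (rule sum.mono_neutral_right) (use i \<open>Suc i < n\<close> in \<open>auto simp: jordan_like_def\<close>)
  then show ?thesis using True i \<open>Suc i < n\<close> by (simp add: jordan_like_def algebra_simps)
next
  case False
  have "(\<Sum>k = 0..<n. jordan_like p n g s $$ (i, k) * f k) = (\<Sum>k\<in>{i}. jordan_like p n g s $$ (i, k) * f k)"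
    by (rule sum.mono_neutral_right) (use i False in \<open>auto simp: jordan_like_def\<close>)
  then show ?thesis using False i by (auto simp: jordan_like_def)
qed

lemma jordan_like_mult:
  assumes "2 * p \<le> n"
  shows "jordan_like p n g s * jordan_like p n g' s' = jordan_like p n (\<lambda>b. g b * g' b) (\<lambda>b. s b + s' b)"
proof (rule eq_matI)
  fix i j assume "i < dim_row (jordan_like p n (\<lambda>b. g b * g' b) (\<lambda>b. s b + s' b))"
    "j < dim_col (jordan_like p n (\<lambda>b. g b * g' b) (\<lambda>b. s b + s' b))"
  then have ij: "i < n" "j < n" by (auto simp: jordan_like_def)
  have S: "Suc i < n" "block_index p (Suc i) = block_index p i" if "even i" "i < 2 * p"
  proof -
    have "Suc i \<noteq> 2 * p" using that by presburger
    then show "Suc i < n" "block_index p (Suc i) = block_index p i"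
      using that assms by (auto simp: block_index_def)
  qed
  have "(jordan_like p n g s * jordan_like p n g' s') $$ (i, j) =
      (\<Sum>k = 0..<n. jordan_like p n g s $$ (i, k) * jordan_like p n g' s' $$ (k, j))"
    using ij by (simp add: scalar_prod_def jordan_like_def)
  also have "\<dots> = jordan_like p n (\<lambda>b. g b * g' b) (\<lambda>b. s b + s' b) $$ (i, j)"
    unfolding jordan_like_row_sum[OF ij(1) assms]
    using ij S by (auto simp: jordan_like_def algebra_simps)
  finally show "(jordan_like p n g s * jordan_like p n g' s') $$ (i, j) =
    jordan_like p n (\<lambda>b. g b * g' b) (\<lambda>b. s b + s' b) $$ (i, j)" .
qed (auto simp: jordan_like_def)

lemma jordan_like_pow:
  assumes "2 * p \<le> n"
  shows "jordan_like p n g s ^\<^sub>m m = jordan_like p n (\<lambda>b. g b ^ m) (\<lambda>b. real m * s b)"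
proof (induction m)
  case 0
  show ?case using jordan_like_one[of p n] by (simp add: jordan_like_def)
next
  case (Suc m)
  then show ?case using assms by (simp add: jordan_like_mult algebra_simps)
qed

lemma jordan_matrix_Cons:
  "jordan_matrix ((k, a) # xs) =
     four_block_mat (jordan_block k a) (0\<^sub>m k (sum_list (map fst xs)))
       (0\<^sub>m (sum_list (map fst xs)) k) (jordan_matrix xs)"
  using jordan_matrix_dim[of xs] unfolding jordan_matrix_def by (simp add: Let_def)

text \<open>The superdiagonal entry \<open>g * s\<close> of a Jordan block is 1, which forces
  \<open>s = 1 / g\<close>. The induction peels off leading blocks, first those of size 2.\<close>

lemma jordan_matrix_blocks:
  assumes "length \<gamma>s = p + q" "\<And>b. b < p \<Longrightarrow> \<gamma>s ! b \<noteq> 0"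
  shows "jordan_matrix (zip (replicate p 2 @ replicate q 1) \<gamma>s) =
    jordan_like p (2 * p + q) ((!) \<gamma>s) (\<lambda>b. 1 / \<gamma>s ! b)"
  using assms
proof (induction p arbitrary: \<gamma>s)
  case 0
  then show ?case
  proof (induction q arbitrary: \<gamma>s)
    case 0
    then show ?case by (auto simp: jordan_matrix_def jordan_like_def)
  next
    case (Suc q)
    then obtain a \<gamma>s' where \<gamma>s: "\<gamma>s = a # \<gamma>s'" "length \<gamma>s' = q" by (cases \<gamma>s) auto
    have IH: "jordan_matrix (zip (replicate q 1) \<gamma>s') = jordan_like 0 q ((!) \<gamma>s') (\<lambda>b. 1 / \<gamma>s' ! b)"
      using Suc.IH[of \<gamma>s'] \<gamma>s by simp
    have "map fst (zip (replicate q 1) \<gamma>s') = replicate q (1::nat)" using \<gamma>s by simp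
    then show ?case using \<gamma>s
      by (intro eq_matI) (auto simp: jordan_matrix_Cons IH[simplified] jordan_like_def block_index_def sum_list_replicate less_Suc_eq_0_disj split: if_splits)
  qed
next
  case (Suc p)
  then obtain a \<gamma>s' where \<gamma>s: "\<gamma>s = a # \<gamma>s'" "length \<gamma>s' = p + q" by (cases \<gamma>s) auto
  have nz: "\<gamma>s' ! b \<noteq> 0" if "b < p" for b
    using Suc.prems(2)[of "Suc b"] that \<gamma>s by auto
  have a: "a \<noteq> 0" using Suc.prems(2)[of 0] \<gamma>s by auto
  let ?xs = "zip (replicate p 2 @ replicate q 1) \<gamma>s'"
  have IH: "jordan_matrix ?xs = jordan_like p (2 * p + q) ((!) \<gamma>s') (\<lambda>b. 1 / \<gamma>s' ! b)"
    using Suc.IH[OF \<gamma>s(2) nz] by simp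
  have "map fst ?xs = replicate p (2::nat) @ replicate q 1" using \<gamma>s by simp
  then have sl: "sum_list (map fst ?xs) = 2 * p + q" by (simp add: sum_list_replicate)
  have "jordan_matrix (zip (replicate (Suc p) 2 @ replicate q 1) \<gamma>s) = jordan_matrix ((2, a) # ?xs)"
    using \<gamma>s by simp
  also have "\<dots> = jordan_like (Suc p) (2 * Suc p + q) ((!) \<gamma>s) (\<lambda>b. 1 / \<gamma>s ! b)"
  proof (rule eq_matI)
    fix i j assume "i < dim_row (jordan_like (Suc p) (2 * Suc p + q) ((!) \<gamma>s) (\<lambda>b. 1 / \<gamma>s ! b))"
     "j < dim_col (jordan_like (Suc p) (2 * Suc p + q) ((!) \<gamma>s) (\<lambda>b. 1 / \<gamma>s ! b))"
    then have ij: "i < 2 * Suc p + q" "j < 2 * Suc p + q" by (auto simp: jordan_like_def)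
    have entry: "jordan_matrix ((2, a) # ?xs) $$ (i, j) =
        (if i < 2 then if j < 2 then jordan_block 2 a $$ (i, j) else 0
         else if j < 2 then 0 else jordan_like p (2 * p + q) ((!) \<gamma>s') (\<lambda>b. 1 / \<gamma>s' ! b) $$ (i - 2, j - 2))"
      unfolding jordan_matrix_Cons sl IH using ij by (simp add: jordan_like_def)
    \<comment> \<open>This split matches the simplification rules for
      \<open>block_index (Suc p)\<close>.\<close>
    have cases: "k = 0 \<or> k = 1 \<or> (\<exists>k'. k = Suc (Suc k'))" for k :: nat
      by presburger
    show "jordan_matrix ((2, a) # ?xs) $$ (i, j) = jordan_like (Suc p) (2 * Suc p + q) ((!) \<gamma>s) (\<lambda>b. 1 / \<gamma>s ! b) $$ (i, j)"
      unfolding entry using cases[of i] cases[of j] ij a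
      by (elim disjE exE) (simp_all add: jordan_like_def \<gamma>s(1))
  qed (simp_all add: sl jordan_like_def del: One_nat_def)
  finally show ?case .
qed

lemma tuple_power_jordan_like:
  assumes "2 * p \<le> n" "length ms = length gs"
  shows "tuple_power n (map (\<lambda>(g, s). jordan_like p n g s) gs) ms =
    jordan_like p n (\<lambda>b. \<Prod>k<length gs. fst (gs ! k) b ^ (ms ! k)) (\<lambda>b. \<Sum>k<length gs. real (ms ! k) * snd (gs ! k) b)"
  using assms(2)
proof (induction gs arbitrary: ms)
  case Nil
  then show ?case using jordan_like_one[of p n] by (simp add: tuple_power_def)
next
  case (Cons g gs)
  then obtain m ms' where ms: "ms = m # ms'" "length ms' = length gs" by (cases ms) auto
  have "tuple_power n (map (\<lambda>(g, s). jordan_like p n g s) (g # gs)) ms =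
    jordan_like p n (fst g) (snd g) ^\<^sub>m m * tuple_power n (map (\<lambda>(g, s). jordan_like p n g s) gs) ms'"
    by (simp add: tuple_power_def ms(1) case_prod_beta)
  then show ?case using assms(1) ms
    by (simp add: Cons.IH jordan_like_pow jordan_like_mult prod.lessThan_Suc_shift sum.lessThan_Suc_shift del: prod.lessThan_Suc sum.lessThan_Suc)
qed

definition start_vec :: "nat \<Rightarrow> nat \<Rightarrow> real Matrix.vec" where
  "start_vec p n = Matrix.vec n (\<lambda>i. if even i \<and> i < 2 * p then 0 else 1)"

lemma coords_jordan_like_start:
  assumes "2 * p \<le> n"
  shows "coords (jordan_like p n g s *\<^sub>v start_vec p n) = (\<lambda>i. if i < n then
     (if even i \<and> i < 2 * p then g (block_index p i) * s (block_index p i) else g (block_index p i)) else 0)"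
proof (rule ext)
  fix i
  show "coords (jordan_like p n g s *\<^sub>v start_vec p n) i = (if i < n then
     (if even i \<and> i < 2 * p then g (block_index p i) * s (block_index p i) else g (block_index p i)) else 0)"
  proof (cases "i < n")
    case True
    have S: "Suc i < n" if "even i" "i < 2 * p"
    proof -
      have "Suc i \<noteq> 2 * p" using that by presburger
      then show "Suc i < n" using that assms by auto
    qed
    have "vec_index (jordan_like p n g s *\<^sub>v start_vec p n) i =
      (\<Sum>k = 0..<n. jordan_like p n g s $$ (i, k) * (if even k \<and> k < 2 * p then 0 else 1))"
      using True by (simp add: scalar_prod_def jordan_like_def start_vec_def)
    then show ?thesis
      unfolding jordan_like_row_sum[OF True assms] using True S
      by (auto simp: coords_def jordan_like_def)
  qed (simp add: coords_def jordan_like_def)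
qed

section \<open>Density through coordinatewise limits\<close>

text \<open>Points without zero coordinates are already dense and closures are closed. Restricting
  to them permits the logarithms and quotients of coordinates used later.\<close>

lemma dense_in_RnI:
  assumes S: "S \<subseteq> carrier_vec n"
    and lim: "\<And>y. (\<forall>i<n. y i \<noteq> 0) \<Longrightarrow>
      \<exists>f. (\<forall>r. f r \<in> S) \<and> (\<forall>i<n. (\<lambda>r::nat. coords (f r) i) \<longlonglongrightarrow> y i)"
  shows "dense_in_Rn n S"
proof -
  define E where "E = {y::nat \<Rightarrow> real. \<forall>i\<ge>n. y i = 0}"
  have sub: "coords ` S \<subseteq> E"
    using S by (auto simp: coords_def E_def)
  have generic: "y \<in> closure (coords ` S)" if y: "y \<in> E" "\<forall>i<n. y i \<noteq> 0" for y
  proof -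
    obtain f where f: "\<And>r. f r \<in> S" "\<And>i. i < n \<Longrightarrow> (\<lambda>r::nat. coords (f r) i) \<longlonglongrightarrow> y i"
      using lim[OF y(2)] by blast
    have "(\<lambda>r. coords (f r) i) \<longlonglongrightarrow> y i" for i
    proof (cases "i < n")
      case False
      then have "coords (f r) i = 0" for r
        using sub f(1)[of r] by (auto simp: E_def)
      with False y(1) show ?thesis by (simp add: E_def)
    qed (use f in auto)
    then have "limitin (powertop_real UNIV) (\<lambda>r. coords (f r)) y sequentially"
      by (simp add: limitin_componentwise)
    then have "(\<lambda>r. coords (f r)) \<longlonglongrightarrow> y"
      by (simp add: euclidean_product_topology)
    then show ?thesis
      unfolding closure_sequential using f(1) by (intro exI[of _ "\<lambda>r. coords (f r)"]) simp
  qed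
  have "E \<subseteq> closure (coords ` S)"
  proof
    fix y assume y: "y \<in> E"
    \<comment> \<open>Zero coordinates are perturbed to \<open>1 / (r + 1)\<close>, so that
      \<open>generic\<close> applies to each \<open>z r\<close>.\<close>
    define z where "z = (\<lambda>r i. if i < n \<and> y i = 0 then inverse (real (Suc r)) else y i)"
    have "(\<lambda>r. z r i) \<longlonglongrightarrow> y i" for i
    proof (cases "i < n \<and> y i = 0")
      case True
      then show ?thesis using LIMSEQ_inverse_real_of_nat by (simp add: z_def)
    next
      case False
      show ?thesis unfolding z_def if_not_P[OF False] by (rule tendsto_const)
    qed
    then have "limitin (powertop_real UNIV) z y sequentially"
      by (simp add: limitin_componentwise)
    then have "z \<longlonglongrightarrow> y"
      by (simp add: euclidean_product_topology)
    moreover have "z r \<in> closure (coords ` S)" for r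
      by (rule generic) (use y in \<open>auto simp: z_def E_def\<close>)
    ultimately show "y \<in> closure (coords ` S)"
      using closed_sequentially[OF closed_closure] by blast
  qed
  then have "Euclidean_space n closure_of (coords ` S) = topspace (Euclidean_space n)"
    using sub
    by (auto simp: Euclidean_space_def closure_of_subtopology E_def[symmetric] euclidean_product_topology Int_absorb1)
  with S show ?thesis by (simp add: dense_in_Rn_def)
qed

section \<open>Exponents approximating a given target\<close>

lemma power_sgn_exp:
  fixes x :: real
  assumes "x \<noteq> 0"
  shows "x ^ m = sgn x ^ m * exp (real m * ln \<bar>x\<bar>)"
proof -
  have "x ^ m = (sgn x * \<bar>x\<bar>) ^ m" by (simp add: sgn_mult_abs)
  then show ?thesis using assms by (simp add: power_mult_distrib exp_of_nat_mult)
qed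

text \<open>The target is a combination of the first \<open>n\<close> generators with coefficients
  \<open>w i\<close>, by \<open>surj\<close>. Since the last generator is
  \<open>- \<Sum> \<theta> i * v i\<close>, exponents \<open>m i\<close> and \<open>k\<close>
  realise the coefficients \<open>m i - k * \<theta> i\<close>, which can be brought close to
  \<open>w i\<close>.\<close>

lemma dense_exponents:
  fixes \<gamma> :: "nat \<Rightarrow> nat \<Rightarrow> real"
  assumes "p \<le> n" "p\<^sub>1 \<le> p"
    and pos: "\<forall>i<n. 0 < \<theta> i" and ind: "independent_with_one n \<theta>"
    and nz: "\<forall>i\<le>n. \<forall>b<p. \<gamma> i b \<noteq> 0"
    and ln_last: "\<forall>b<p. ln \<bar>\<gamma> n b\<bar> = - (\<Sum>i<n. \<theta> i * ln \<bar>\<gamma> i b\<bar>)"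
    and inv_last: "\<forall>j<p\<^sub>1. 1 / \<gamma> n j = - (\<Sum>i<n. \<theta> i * (1 / \<gamma> i j))"
    and neg: "\<forall>i<p. \<forall>b<p. \<gamma> i b < 0 \<longleftrightarrow> i = b"
    and surj: "\<forall>A B. \<exists>w. (\<forall>b<p. (\<Sum>i<n. w i * ln \<bar>\<gamma> i b\<bar>) = A b) \<and>
                (\<forall>j<p\<^sub>1. (\<Sum>i<n. w i * (1 / \<gamma> i j)) = B j)"
    and G: "\<forall>b<p. G b \<noteq> 0"
  shows "\<exists>m :: nat \<Rightarrow> nat \<Rightarrow> nat.
    (\<forall>b<p. (\<lambda>r. \<Prod>i<Suc n. \<gamma> i b ^ m r i) \<longlonglongrightarrow> G b) \<and>
    (\<forall>j<p\<^sub>1. (\<lambda>r. \<Sum>i<Suc n. real (m r i) * (1 / \<gamma> i j)) \<longlonglongrightarrow> B j)"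
proof -
  obtain w where wA: "\<And>b. b < p \<Longrightarrow> (\<Sum>i<n. w i * ln \<bar>\<gamma> i b\<bar>) = ln \<bar>G b\<bar>"
    and wB: "\<And>j. j < p\<^sub>1 \<Longrightarrow> (\<Sum>i<n. w i * (1 / \<gamma> i j)) = B j"
    using surj[rule_format, of "\<lambda>b. ln \<bar>G b\<bar>" B] by blast
  \<comment> \<open>Exponents are to be odd exactly at those \<open>b < p\<close> where the target
    is negative.\<close>
  define e :: "nat \<Rightarrow> nat" where "e = (\<lambda>i. if i < p \<and> G i < 0 then 1 else 0)"
  have "\<exists>k m'. even k \<and> (\<forall>i<n. even (m' i) = even (e i)) \<and>
      (\<forall>i<n. \<bar>real (m' i) - real k * \<theta> i - w i\<bar> < inverse (real (Suc r)))" for r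
    by (rule Kronecker_nat_parity) (use pos ind in auto)
  then obtain k m' where k: "\<And>r. even (k r)" and m': "\<And>r i. i < n \<Longrightarrow> even (m' r i) = even (e i)"
    and appr: "\<And>r i. i < n \<Longrightarrow> \<bar>real (m' r i) - real (k r) * \<theta> i - w i\<bar> < inverse (real (Suc r))"
    by metis
  define m where "m = (\<lambda>r i. if i < n then m' r i else k r)"
  have lim: "(\<lambda>r. real (m' r i) - real (k r) * \<theta> i) \<longlonglongrightarrow> w i" if "i < n" for i
  proof (rule LIM_zero_cancel, rule Lim_null_comparison)
    show "\<forall>\<^sub>F r in sequentially. norm (real (m' r i) - real (k r) * \<theta> i - w i) \<le> inverse (real (Suc r))"
      using appr[OF that] by (simp add: less_imp_le)
  qed (rule LIMSEQ_inverse_real_of_nat)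
  \<comment> \<open>Stated for general \<open>v\<close> because it is applied both to logarithms and
    to reciprocals.\<close>
  have lim_sum: "(\<lambda>r. \<Sum>i<Suc n. real (m r i) * v i) \<longlonglongrightarrow> (\<Sum>i<n. w i * v i)"
    if v: "v n = - (\<Sum>i<n. \<theta> i * v i)" for v
  proof -
    have eq: "(\<Sum>i<Suc n. real (m r i) * v i) = (\<Sum>i<n. (real (m' r i) - real (k r) * \<theta> i) * v i)" for r
      by (simp add: m_def v sum_subtractf sum_distrib_left left_diff_distrib mult.assoc)
    show ?thesis unfolding eq by (intro tendsto_sum tendsto_mult tendsto_const lim) simp
  qed
  have prod: "(\<Prod>i<Suc n. \<gamma> i b ^ m r i) = sgn (G b) * exp (\<Sum>i<Suc n. real (m r i) * ln \<bar>\<gamma> i b\<bar>)"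
    if b: "b < p" for b r
  proof -
    have "b < n" using b assms(1) by simp
    have "\<gamma> b b < 0" using neg b by simp
    have "(\<Prod>i<Suc n. sgn (\<gamma> i b) ^ m r i) = sgn (\<gamma> b b) ^ m r b * (\<Prod>i\<in>{..<Suc n}-{b}. sgn (\<gamma> i b) ^ m r i)"
      using \<open>b < n\<close> by (intro prod.remove) auto
    \<comment> \<open>For \<open>i < p\<close> the eigenvalue is positive. From \<open>p\<close> on
      its sign is unknown, but the exponent is even, including \<open>k r\<close> at index
      \<open>n\<close>.\<close>
    also have "(\<Prod>i\<in>{..<Suc n}-{b}. sgn (\<gamma> i b) ^ m r i) = 1"
    proof (rule prod.neutral, rule ballI)
      fix i assume i: "i \<in> {..<Suc n}-{b}"
      then have "\<gamma> i b \<noteq> 0" using nz b by auto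
      show "sgn (\<gamma> i b) ^ m r i = 1"
      proof (cases "i < p")
        case True
        then have "\<gamma> i b > 0" using neg b i \<open>\<gamma> i b \<noteq> 0\<close> by (metis DiffD2 insertCI linorder_neqE_linordered_idom)
        then show ?thesis by simp
      next
        case False
        then have "even (m r i)" using k m' i by (auto simp: m_def e_def)
        then show ?thesis using \<open>\<gamma> i b \<noteq> 0\<close> by (auto elim!: evenE simp: power_mult sgn_if)
      qed
    qed
    also have "sgn (\<gamma> b b) ^ m r b = sgn (G b)"
      using \<open>\<gamma> b b < 0\<close> b G m'[OF \<open>b < n\<close>, of r] \<open>b < n\<close>
      by (auto simp: m_def e_def sgn_if not_less le_less split: if_splits)
    finally have "(\<Prod>i<Suc n. sgn (\<gamma> i b) ^ m r i) = sgn (G b)" by simp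
    moreover have "(\<Prod>i<Suc n. \<gamma> i b ^ m r i) = (\<Prod>i<Suc n. sgn (\<gamma> i b) ^ m r i * exp (real (m r i) * ln \<bar>\<gamma> i b\<bar>))"
      using nz b by (intro prod.cong power_sgn_exp) auto
    ultimately show ?thesis
      by (simp only: prod.distrib exp_sum finite_lessThan)
  qed
  have "(\<lambda>r. \<Prod>i<Suc n. \<gamma> i b ^ m r i) \<longlonglongrightarrow> G b" if b: "b < p" for b
  proof -
    have "(\<lambda>r. \<Sum>i<Suc n. real (m r i) * ln \<bar>\<gamma> i b\<bar>) \<longlonglongrightarrow> ln \<bar>G b\<bar>"
      using lim_sum[of "\<lambda>i. ln \<bar>\<gamma> i b\<bar>"] ln_last b wA[OF b] by simp
    then have "(\<lambda>r. \<Prod>i<Suc n. \<gamma> i b ^ m r i) \<longlonglongrightarrow> sgn (G b) * exp (ln \<bar>G b\<bar>)"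
      unfolding prod[OF b] by (intro tendsto_intros)
    then show ?thesis using G b by (simp add: sgn_mult_abs)
  qed
  moreover have "(\<lambda>r. \<Sum>i<Suc n. real (m r i) * (1 / \<gamma> i j)) \<longlonglongrightarrow> B j" if "j < p\<^sub>1" for j
    using lim_sum[of "\<lambda>i. 1 / \<gamma> i j"] inv_last that wB[OF that] by simp
  ultimately show ?thesis by blast
qed

section \<open>Assembly of the tuple and density of its orbit\<close>

theorem theorem1p10:
  fixes n p\<^sub>1 p\<^sub>2 :: nat
  assumes "n \<ge> 2" and "p\<^sub>1 \<ge> 1" and "2 * p\<^sub>1 + p\<^sub>2 = n"
  shows "\<exists>ns Ts. mset ns = replicate_mset p\<^sub>1 2 + replicate_mset p\<^sub>2 1 \<and>
                 length Ts = n + 1 \<and>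
                 jordan_form_tuple ns Ts \<and>
                 hypercyclic n Ts"
proof -
  define p where "p = p\<^sub>1 + p\<^sub>2"
  have n: "n = p + p\<^sub>1" "2 * p\<^sub>1 \<le> n" using assms by (auto simp: p_def)
  obtain \<theta> where \<theta>: "\<forall>i<n. 0 < \<theta> i" "\<forall>i<n. \<theta> i < 1 / real n"
    and ind: "independent_with_one n \<theta>"
    using exists_independent_small[of "1 / real n" n] assms(1) by auto
  have "(\<Sum>i<n. \<theta> i) < (\<Sum>i<n. 1 / real n)"
    using \<theta>(2) assms(1) by (intro sum_strict_mono) (auto simp: lessThan_empty_iff)
  then have small: "(\<Sum>i<n. \<theta> i) < 1" using assms(1) by simp
  obtain \<gamma> :: "nat \<Rightarrow> nat \<Rightarrow> real" where
    nz: "\<forall>i\<le>n. \<forall>b<p. \<gamma> i b \<noteq> 0" and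
    \<gamma>: "\<forall>b<p. ln \<bar>\<gamma> n b\<bar> = - (\<Sum>i<n. \<theta> i * ln \<bar>\<gamma> i b\<bar>)"
      "\<forall>j<p\<^sub>1. 1 / \<gamma> n j = - (\<Sum>i<n. \<theta> i * (1 / \<gamma> i j))"
      "\<forall>i<p. \<forall>b<p. \<gamma> i b < 0 \<longleftrightarrow> i = b"
      "\<forall>A B. \<exists>w. (\<forall>b<p. (\<Sum>i<n. w i * ln \<bar>\<gamma> i b\<bar>) = A b) \<and>
                (\<forall>j<p\<^sub>1. (\<Sum>i<n. w i * (1 / \<gamma> i j)) = B j)"
    using exists_eigenvalues[OF assms(2) p_def n(1) \<theta>(1) small] by (elim exE conjE)
  define ns :: "nat list" where "ns = replicate p\<^sub>1 2 @ replicate p\<^sub>2 1"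
  define T where "T = (\<lambda>i. jordan_like p\<^sub>1 n (\<gamma> i) (\<lambda>b. 1 / \<gamma> i b))"
  define Ts where "Ts = map T [0..<Suc n]"
  have jordan: "T i = jordan_matrix (zip ns (map (\<gamma> i) [0..<p]))" if "i \<le> n" for i
  proof -
    have "jordan_matrix (zip ns (map (\<gamma> i) [0..<p])) =
      jordan_like p\<^sub>1 (2 * p\<^sub>1 + p\<^sub>2) ((!) (map (\<gamma> i) [0..<p])) (\<lambda>b. 1 / map (\<gamma> i) [0..<p] ! b)"
      unfolding ns_def by (rule jordan_matrix_blocks) (use nz that in \<open>auto simp: p_def\<close>)
    also have "\<dots> = T i"
      unfolding T_def assms(3) by (rule jordan_like_cong) (use n in \<open>auto simp: p_def\<close>)
    finally show ?thesis ..
  qed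
  have "jordan_form_tuple ns Ts"
    unfolding jordan_form_tuple_def
  proof (intro conjI ballI)
    fix A assume "A \<in> set Ts"
    then obtain i where "i \<le> n" "A = T i" by (force simp: Ts_def less_Suc_eq_le simp del: upt_Suc)
    then show "\<exists>\<gamma>s. length \<gamma>s = length ns \<and> A = jordan_matrix (zip ns \<gamma>s)"
      using jordan by (intro exI[of _ "map (\<gamma> i) [0..<p]"]) (simp add: ns_def p_def)
  qed (auto simp: ns_def)
  moreover have "hypercyclic n Ts"
    unfolding hypercyclic_def
  proof (intro conjI bexI[of _ "start_vec p\<^sub>1 n"] ballI dense_in_RnI)
    show "set Ts \<subseteq> carrier_mat n n" by (auto simp: Ts_def T_def)
    show "A * B = B * A" if "A \<in> set Ts" "B \<in> set Ts" for A B
      using that n(2) by (auto simp: Ts_def T_def jordan_like_mult mult.commute add.commute)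
    show "start_vec p\<^sub>1 n \<in> carrier_vec n" by (simp add: start_vec_def)
    define gs where "gs = map (\<lambda>i. (\<gamma> i, \<lambda>b. 1 / \<gamma> i b)) [0..<Suc n]"
    have Ts_gs: "Ts = map (\<lambda>(g, s). jordan_like p\<^sub>1 n g s) gs"
      by (simp add: Ts_def gs_def T_def)
    have gs: "length gs = Suc n" "\<And>i. i < Suc n \<Longrightarrow> gs ! i = (\<gamma> i, \<lambda>b. 1 / \<gamma> i b)"
      by (simp_all add: gs_def del: upt_Suc)
    have power: "tuple_power n Ts ms = jordan_like p\<^sub>1 n (\<lambda>b. \<Prod>i<Suc n. \<gamma> i b ^ (ms ! i))
        (\<lambda>b. \<Sum>i<Suc n. real (ms ! i) * (1 / \<gamma> i b))" if "length ms = length Ts" for ms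
      unfolding Ts_gs using that n(2) by (subst tuple_power_jordan_like) (auto simp: Ts_gs gs cong: prod.cong_simp sum.cong_simp)
    show "{tuple_power n Ts ms *\<^sub>v start_vec p\<^sub>1 n | ms. length ms = length Ts} \<subseteq> carrier_vec n"
    proof clarify
      fix ms :: "nat list" assume "length ms = length Ts"
      then show "tuple_power n Ts ms *\<^sub>v start_vec p\<^sub>1 n \<in> carrier_vec n"
        by (simp add: power carrier_vecI jordan_like_def)
    qed
    fix y :: "nat \<Rightarrow> real" assume y: "\<forall>i<n. y i \<noteq> 0"
    \<comment> \<open>The coordinate in which block \<open>b\<close> carries \<open>g\<close> alone:
      the second one of a block of size 2, or the only one of a block of size 1. The first
      coordinate \<open>2 * b\<close> of a block of size 2 carries \<open>g * s\<close>, so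
      \<open>s\<close> must approach \<open>y (2 * b) / y (pos b)\<close>.\<close>
    define pos where "pos = (\<lambda>b. if b < p\<^sub>1 then 2 * b + 1 else b + p\<^sub>1)"
    have "p \<le> n" "p\<^sub>1 \<le> p" "\<forall>b<p. y (pos b) \<noteq> 0"
      using y n by (auto simp: pos_def p_def)
    from dense_exponents[OF this(1,2) \<theta>(1) ind nz \<gamma> this(3), of "\<lambda>b. y (2 * b) / y (pos b)"]
    obtain m :: "nat \<Rightarrow> nat \<Rightarrow> nat" where
      m1: "\<And>b. b < p \<Longrightarrow> (\<lambda>r. \<Prod>i<Suc n. \<gamma> i b ^ m r i) \<longlonglongrightarrow> y (pos b)" and
      m2: "\<And>j. j < p\<^sub>1 \<Longrightarrow> (\<lambda>r. \<Sum>i<Suc n. real (m r i) * (1 / \<gamma> i j)) \<longlonglongrightarrow> y (2 * j) / y (pos j)"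
      by blast
    define f where "f = (\<lambda>r. tuple_power n Ts (map (m r) [0..<Suc n]) *\<^sub>v start_vec p\<^sub>1 n)"
    have f: "coords (f r) i = (let b = block_index p\<^sub>1 i in (\<Prod>i<Suc n. \<gamma> i b ^ m r i) *
        (if even i \<and> i < 2 * p\<^sub>1 then \<Sum>i<Suc n. real (m r i) * (1 / \<gamma> i b) else 1))" if "i < n" for r i
    proof -
      have nth: "map (m r) [0..<Suc n] ! i = m r i" if "i < Suc n" for i
        using that by (simp del: upt_Suc)
      have "tuple_power n Ts (map (m r) [0..<Suc n]) = jordan_like p\<^sub>1 n (\<lambda>b. \<Prod>i<Suc n. \<gamma> i b ^ m r i)
        (\<lambda>b. \<Sum>i<Suc n. real (m r i) * (1 / \<gamma> i b))"
        by (subst power) (simp_all add: Ts_def nth del: upt_Suc prod.lessThan_Suc sum.lessThan_Suc cong: prod.cong_simp sum.cong_simp)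
      then show ?thesis using that
        by (simp add: f_def coords_jordan_like_start[OF n(2)] Let_def del: prod.lessThan_Suc sum.lessThan_Suc)
    qed
    show "\<exists>f. (\<forall>r. f r \<in> {tuple_power n Ts ms *\<^sub>v start_vec p\<^sub>1 n | ms. length ms = length Ts}) \<and>
      (\<forall>i<n. (\<lambda>r. coords (f r) i) \<longlonglongrightarrow> y i)"
    proof (intro exI[of _ f] conjI allI impI)
      show "f r \<in> {tuple_power n Ts ms *\<^sub>v start_vec p\<^sub>1 n | ms. length ms = length Ts}" for r
        unfolding f_def by (intro CollectI exI[of _ "map (m r) [0..<Suc n]"]) (simp add: Ts_def)
      fix i assume i: "i < n"
      define b where "b = block_index p\<^sub>1 i"
      have b: "b < p" using i n by (auto simp: b_def block_index_def p_def)
      show "(\<lambda>r. coords (f r) i) \<longlonglongrightarrow> y i"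
      proof (cases "even i \<and> i < 2 * p\<^sub>1")
        case True
        then have bi: "b < p\<^sub>1" "2 * b = i" by (auto simp: b_def block_index_def)
        then have "y (pos b) \<noteq> 0" using y n by (auto simp: pos_def)
        have "(\<lambda>r. coords (f r) i) \<longlonglongrightarrow> y (pos b) * (y (2 * b) / y (pos b))"
          unfolding f[OF i] Let_def b_def[symmetric] if_P[OF True]
          by (intro tendsto_mult m1 m2 b bi)
        then show ?thesis using bi \<open>y (pos b) \<noteq> 0\<close> by simp
      next
        case False
        then have "pos b = i" using i n by (auto simp: b_def block_index_def pos_def)
        moreover have "(\<lambda>r. coords (f r) i) \<longlonglongrightarrow> y (pos b) * 1"
          unfolding f[OF i] Let_def b_def[symmetric] if_not_P[OF False]
          by (intro tendsto_mult m1 b tendsto_const)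
        ultimately show ?thesis by simp
      qed
    qed
  qed
  ultimately show ?thesis
    by (intro exI[of _ ns] exI[of _ Ts]) (simp add: ns_def Ts_def)
qed

end
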